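(* Let $X$ be a metrizable topological space and let $\mathcal{F}$ be a weakly equicontinuous decomposition on $X$. Then: (1) $\mathcal{F}$ is of characteristic $0$. (2) $\mathcal{F}$ is $R$-closed. (3) The class space $X/\hat{\mathcal{F}}$ is Hausdorff. Moreover, if the element closure $\overline{\mathcal{F}(x)}$ is compact for every $x\in X$, then: (4) $\mathcal{F}$ is weakly almost periodic. (5) The class decomposition $\hat{\mathcal{F}}$ is an upper semi-continuous decomposition. (6) For every $x\in X$ and every neighborhood $U$ of $\overline{\mathcal{F}(x)}$, there is an open invariant (with respect to $\mathcal{F}$) neighborhood $V\subseteq U$ of $\overline{\mathcal{F}(x)}$.
   Context: A decomposition of a set $X$ is a family $\mathcal{F}$ of pairwise disjoint non-empty subsets of $X$ whose union is $X$; $\mathcal{F}(x)$ denotes the element of $\mathcal{F}$ containing $x$. The element closure of $x$ is $\overline{\mathcal{F}(x)}$. A subset of $X$ is invariant if it is a union of elements of $\mathcal{F}$. For non-empty subsets $A,B$ of a metric space $(X,d)$, $d_H(A,B):=\inf\{\varepsilon>0\mid A\subseteq U_\varepsilon(B),\ B\subseteq U_\varepsilon(A)\}\in\mathbb{R}_{\ge 0}\sqcup\{\infty\}$, where $U_\varepsilon(C):=\bigcup_{x\in C}\{y\in X\mid d(y,x)<\varepsilon\}$ (with $\inf\emptyset=\infty$). $\mathcal{F}$ on a metric space $(X,d)$ is weakly equicontinuous if for every $\varepsilon>0$ there is $\delta>0$ such that $d_H(\mathcal{F}(x),\mathcal{F}(y))<\varepsilon$ for all $x,y\in X$ with $d(x,y)<\delta$.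 On a metrizable space, $\mathcal{F}$ is weakly equicontinuous if this holds for some metric compatible with the topology. $\mathcal{F}$ is $R$-closed if $R=\{(x,y)\in X\times X\mid y\in\overline{\mathcal{F}(x)}\}$ is closed in $X\times X$. The (bilateral) prolongation of $x$ is $D(x)=\{y\in X\mid \text{there are nets }(x_\alpha),(y_\alpha)\text{ in }X\text{ (with the same index set) such that } y_\alpha\in\mathcal{F}(x_\alpha),\ y_\alpha\to y,\ x_\alpha\to x\}$; $\mathcal{F}$ is of characteristic $0$ if $\overline{\mathcal{F}(x)}=D(x)$ for every $x\in X$. The element class of $x$ is $\hat{\mathcal{F}}(x):=\{y\in X\mid\overline{\mathcal{F}(x)}=\overline{\mathcal{F}(y)}\}$; the class decomposition $\hat{\mathcal{F}}$ is the decomposition of $X$ into element classes, and the class space $X/\hat{\mathcal{F}}$ is the quotient space of $X$ obtained by collapsing each element class to a point, with the quotient topology. An invariant subset $A\subseteq X$ is minimal if $A=\overline{\mathcal{F}(x)}$ for every $x\in A$. $\mathcal{F}$ is pointwise almost periodic if every element closure is minimal. $\mathcal{F}$ is weakly almost periodic if it is pointwise almost periodic and, for every closed $A\subseteq X$, the union $\bigcup_{x\in A}\overline{\mathcal{F}(x)}$ is closed. A decomposition $\mathcal{G}$ on $X$ is weakly upper semi-continuous if each element of $\mathcal{G}$ is closed and for every $L\in\mathcal{G}$ and every open neighborhood $U$ of $L$ there is an open neighborhood $V\subseteq U$ of $L$ which is a union of elements of $\mathcal{G}$. It is upper semi-continuous if moreover each element of $\mathcal{G}$ is compact. *)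

theory Defs
  imports "HOL-Analysis.Analysis" "HOL-Library.Disjoint_Sets"
begin

text \<open>A decomposition of \<open>X\<close> is a set \<open>F\<close> with \<^term>\<open>partition_on (topspace X) F\<close>.\<close>

definition elem_of :: "'a set set \<Rightarrow> 'a \<Rightarrow> 'a set" where
  "elem_of F x = (THE L. L \<in> F \<and> x \<in> L)"

definition elem_closure :: "'a topology \<Rightarrow> 'a set set \<Rightarrow> 'a \<Rightarrow> 'a set" where
  "elem_closure X F x = X closure_of (elem_of F x)"

definition invariant :: "'a set set \<Rightarrow> 'a set \<Rightarrow> bool" where
  "invariant F A \<longleftrightarrow> (\<exists>G \<subseteq> F. A = \<Union>G)"

definition U_nbhd :: "'a metric \<Rightarrow> real \<Rightarrow> 'a set \<Rightarrow> 'a set" where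
  "U_nbhd m e C = (\<Union>x\<in>C. {y \<in> mspace m. mdist m y x < e})"

text \<open>The infimum is taken in the extended reals, where \<^prop>\<open>Inf {} = (\<infinity>::ereal)\<close>.\<close>

definition hausdorff_dist :: "'a metric \<Rightarrow> 'a set \<Rightarrow> 'a set \<Rightarrow> ereal" where
  "hausdorff_dist m A B =
     Inf {ereal e | e. e > 0 \<and> A \<subseteq> U_nbhd m e B \<and> B \<subseteq> U_nbhd m e A}"

definition weakly_equicontinuous_metric :: "'a metric \<Rightarrow> 'a set set \<Rightarrow> bool" where
  "weakly_equicontinuous_metric m F \<longleftrightarrow>
     (\<forall>e>0. \<exists>d>0. \<forall>x \<in> mspace m. \<forall>y \<in> mspace m.
        mdist m x y < d \<longrightarrow> hausdorff_dist m (elem_of F x) (elem_of F y) < ereal e)"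

definition weakly_equicontinuous :: "'a topology \<Rightarrow> 'a set set \<Rightarrow> bool" where
  "weakly_equicontinuous X F \<longleftrightarrow>
     (\<exists>m. mtopology_of m = X \<and> weakly_equicontinuous_metric m F)"

definition R_closed :: "'a topology \<Rightarrow> 'a set set \<Rightarrow> bool" where
  "R_closed X F \<longleftrightarrow>
     closedin (prod_topology X X)
       {(x, y). x \<in> topspace X \<and> y \<in> topspace X \<and> y \<in> elem_closure X F x}"

definition directed_set :: "'i set \<Rightarrow> 'i rel \<Rightarrow> bool" where
  "directed_set I r \<longleftrightarrow>
     I \<noteq> {} \<and> (\<forall>a\<in>I. (a, a) \<in> r) \<and>
     (\<forall>a\<in>I. \<forall>b\<in>I. \<forall>c\<in>I. (a, b) \<in> r \<longrightarrow> (b, c) \<in> r \<longrightarrow> (a, c) \<in> r) \<and>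
     (\<forall>a\<in>I. \<forall>b\<in>I. \<exists>c\<in>I. (a, c) \<in> r \<and> (b, c) \<in> r)"

definition net_converges ::
    "'a topology \<Rightarrow> 'i set \<Rightarrow> 'i rel \<Rightarrow> ('i \<Rightarrow> 'a) \<Rightarrow> 'a \<Rightarrow> bool" where
  "net_converges X I r s l \<longleftrightarrow>
     l \<in> topspace X \<and>
     (\<forall>U. openin X U \<and> l \<in> U \<longrightarrow> (\<exists>a\<in>I. \<forall>b\<in>I. (a, b) \<in> r \<longrightarrow> s b \<in> U))"

definition prolongation_nets ::
    "'a topology \<Rightarrow> 'a set set \<Rightarrow> 'a \<Rightarrow> 'a \<Rightarrow> 'i set \<Rightarrow> 'i rel \<Rightarrow> ('i \<Rightarrow> 'a) \<Rightarrow> ('i \<Rightarrow> 'a) \<Rightarrow> bool"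
  where
  "prolongation_nets X F x y I r xs ys \<longleftrightarrow>
     directed_set I r \<and>
     (\<forall>a\<in>I. xs a \<in> topspace X \<and> ys a \<in> topspace X \<and> ys a \<in> elem_of F (xs a)) \<and>
     net_converges X I r ys y \<and> net_converges X I r xs x"

text \<open>
  HOL cannot quantify over the type of indices, so index sets are taken in \<^typ>\<open>'a set \<times> 'a set\<close>,
  which contains the pairs of open neighbourhoods of \<open>x\<close> and \<open>y\<close>. Nets over any other
  index type give nothing more: see \<open>prolongation_any_index\<close> below.
\<close>

definition prolongation :: "'a topology \<Rightarrow> 'a set set \<Rightarrow> 'a \<Rightarrow> 'a set" where
  "prolongation X F x =
     {y \<in> topspace X. \<exists>(I :: ('a set \<times> 'a set) set) r xs ys. prolongation_nets X F x y I r xs ys}"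

definition characteristic_0 :: "'a topology \<Rightarrow> 'a set set \<Rightarrow> bool" where
  "characteristic_0 X F \<longleftrightarrow> (\<forall>x \<in> topspace X. elem_closure X F x = prolongation X F x)"

definition elem_class :: "'a topology \<Rightarrow> 'a set set \<Rightarrow> 'a \<Rightarrow> 'a set" where
  "elem_class X F x = {y \<in> topspace X. elem_closure X F x = elem_closure X F y}"

definition class_decomp :: "'a topology \<Rightarrow> 'a set set \<Rightarrow> 'a set set" where
  "class_decomp X F = elem_class X F ` topspace X"

text \<open>The points of the quotient space are the members of the decomposition \<open>G\<close> themselves;
  the preimage of \<open>W \<subseteq> G\<close> under the projection is \<open>\<Union>W\<close>.\<close>

definition decomp_space :: "'a topology \<Rightarrow> 'a set set \<Rightarrow> 'a set topology" where
  "decomp_space X G = topology (\<lambda>W. W \<subseteq> G \<and> openin X (\<Union>W))"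

definition class_space :: "'a topology \<Rightarrow> 'a set set \<Rightarrow> 'a set topology" where
  "class_space X F = decomp_space X (class_decomp X F)"

definition minimal_set :: "'a topology \<Rightarrow> 'a set set \<Rightarrow> 'a set \<Rightarrow> bool" where
  "minimal_set X F A \<longleftrightarrow> invariant F A \<and> (\<forall>x\<in>A. A = elem_closure X F x)"

definition pointwise_almost_periodic :: "'a topology \<Rightarrow> 'a set set \<Rightarrow> bool" where
  "pointwise_almost_periodic X F \<longleftrightarrow> (\<forall>x \<in> topspace X. minimal_set X F (elem_closure X F x))"

definition weakly_almost_periodic :: "'a topology \<Rightarrow> 'a set set \<Rightarrow> bool" where
  "weakly_almost_periodic X F \<longleftrightarrow>
     pointwise_almost_periodic X F \<and>
     (\<forall>A. closedin X A \<longrightarrow> closedin X (\<Union>x\<in>A. elem_closure X F x))"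

definition weakly_upper_semicontinuous :: "'a topology \<Rightarrow> 'a set set \<Rightarrow> bool" where
  "weakly_upper_semicontinuous X G \<longleftrightarrow>
     partition_on (topspace X) G \<and>
     (\<forall>L\<in>G. closedin X L) \<and>
     (\<forall>L\<in>G. \<forall>U. openin X U \<and> L \<subseteq> U \<longrightarrow>
        (\<exists>V. openin X V \<and> L \<subseteq> V \<and> V \<subseteq> U \<and> invariant G V))"

definition upper_semicontinuous :: "'a topology \<Rightarrow> 'a set set \<Rightarrow> bool" where
  "upper_semicontinuous X G \<longleftrightarrow>
     weakly_upper_semicontinuous X G \<and> (\<forall>L\<in>G. compactin X L)"

definition nbhd_of_set :: "'a topology \<Rightarrow> 'a set \<Rightarrow> 'a set \<Rightarrow> bool" where
  "nbhd_of_set X A U \<longleftrightarrow> U \<subseteq> topspace X \<and> (\<exists>W. openin X W \<and> A \<subseteq> W \<and> W \<subseteq> U)"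

lemma elem_of_eqI:
  assumes "partition_on S F" "L \<in> F" "x \<in> L"
  shows "elem_of F x = L"
  unfolding elem_of_def
proof (rule the_equality)
  show "L \<in> F \<and> x \<in> L" using assms by blast
  show "L' = L" if "L' \<in> F \<and> x \<in> L'" for L'
    using assms that unfolding partition_on_def disjoint_def by blast
qed

lemma prolongation_any_index:
  fixes I :: "'i set"
  assumes nets: "prolongation_nets X F x y I r xs ys"
  shows "y \<in> prolongation X F x"
proof -
  have dir: "directed_set I r"
    and val: "\<And>a. a \<in> I \<Longrightarrow> xs a \<in> topspace X \<and> ys a \<in> topspace X \<and> ys a \<in> elem_of F (xs a)"
    and ycv: "net_converges X I r ys y" and xcv: "net_converges X I r xs x"
    using nets unfolding prolongation_nets_def by auto
  define J where "J = {(U, V). openin X U \<and> x \<in> U \<and> openin X V \<and> y \<in> V}"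
  define q where
    "q = {((U :: 'a set, V :: 'a set), (U', V')). U' \<subseteq> U \<and> V' \<subseteq> V}"
  have xy: "x \<in> topspace X" "y \<in> topspace X"
    using xcv ycv unfolding net_converges_def by auto
  have "\<exists>c\<in>I. xs c \<in> fst p \<and> ys c \<in> snd p" if "p \<in> J" for p
  proof -
    obtain a where a: "a \<in> I" "\<forall>c\<in>I. (a, c) \<in> r \<longrightarrow> xs c \<in> fst p"
      using xcv \<open>p \<in> J\<close> unfolding net_converges_def J_def by fastforce
    obtain b where b: "b \<in> I" "\<forall>c\<in>I. (b, c) \<in> r \<longrightarrow> ys c \<in> snd p"
      using ycv \<open>p \<in> J\<close> unfolding net_converges_def J_def by fastforce
    show ?thesis using dir a b unfolding directed_set_def by blast
  qed
  then obtain c where c: "\<And>p. p \<in> J \<Longrightarrow> c p \<in> I \<and> xs (c p) \<in> fst p \<and> ys (c p) \<in> snd p"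
    by metis
  have top: "(topspace X, topspace X) \<in> J" using xy by (auto simp: J_def)
  have "directed_set J q"
    unfolding directed_set_def
  proof (intro conjI ballI impI)
    show "J \<noteq> {}" using top by blast
    show "\<exists>w\<in>J. (p, w) \<in> q \<and> (p', w) \<in> q" if "p \<in> J" "p' \<in> J" for p p'
      using that by (intro bexI[of _ "(fst p \<inter> fst p', snd p \<inter> snd p')"])
        (auto simp: J_def q_def)
  qed (auto simp: q_def)
  moreover have "net_converges X J q (xs \<circ> c) x"
    unfolding net_converges_def
  proof (intro conjI allI impI)
    show "\<exists>a\<in>J. \<forall>b\<in>J. (a, b) \<in> q \<longrightarrow> (xs \<circ> c) b \<in> U" if "openin X U \<and> x \<in> U" for U
      using that xy c by (intro bexI[of _ "(U, topspace X)"]) (fastforce simp: J_def q_def)+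
  qed (use xy in auto)
  moreover have "net_converges X J q (ys \<circ> c) y"
    unfolding net_converges_def
  proof (intro conjI allI impI)
    show "\<exists>a\<in>J. \<forall>b\<in>J. (a, b) \<in> q \<longrightarrow> (ys \<circ> c) b \<in> V" if "openin X V \<and> y \<in> V" for V
      using that xy c by (intro bexI[of _ "(topspace X, V)"]) (fastforce simp: J_def q_def)+
  qed (use xy in auto)
  ultimately have "prolongation_nets X F x y J q (xs \<circ> c) (ys \<circ> c)"
    using val c unfolding prolongation_nets_def by auto
  then show ?thesis using xy unfolding prolongation_def by blast
qed

lemma openin_decomp_space:
  assumes "disjoint G"
  shows "openin (decomp_space X G) W \<longleftrightarrow> W \<subseteq> G \<and> openin X (\<Union>W)"
proof -
  have Int: "\<Union>(S \<inter> T) = \<Union>S \<inter> \<Union>T" if "S \<subseteq> G" "T \<subseteq> G" for S T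
  proof
    show "\<Union>S \<inter> \<Union>T \<subseteq> \<Union>(S \<inter> T)"
    proof
      fix x assume "x \<in> \<Union>S \<inter> \<Union>T"
      then obtain A B where AB: "A \<in> S" "B \<in> T" "x \<in> A" "x \<in> B" by blast
      have "A = B" using disjointD[OF assms, of A B] AB that by blast
      then show "x \<in> \<Union>(S \<inter> T)" using AB by blast
    qed
  qed blast
  have Un: "\<Union>(\<Union>K) = \<Union>(Union ` K)" for K :: "'a set set set" by blast
  have "istopology (\<lambda>W. W \<subseteq> G \<and> openin X (\<Union>W))"
    unfolding istopology_def
  proof (rule conjI; intro allI impI)
    show "S \<inter> T \<subseteq> G \<and> openin X (\<Union>(S \<inter> T))"
      if "S \<subseteq> G \<and> openin X (\<Union>S)" "T \<subseteq> G \<and> openin X (\<Union>T)" for S T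
    proof
      show "S \<inter> T \<subseteq> G" using that by blast
      show "openin X (\<Union>(S \<inter> T))"
        using that by (metis Int openin_Int)
    qed
    show "\<Union>K \<subseteq> G \<and> openin X (\<Union>(\<Union>K))"
      if K: "\<forall>S\<in>K. S \<subseteq> G \<and> openin X (\<Union>S)" for K
    proof
      show "\<Union>K \<subseteq> G" using K by blast
      show "openin X (\<Union>(\<Union>K))"
        unfolding Un by (rule openin_Union) (use K in blast)
    qed
  qed
  then show ?thesis unfolding decomp_space_def by (simp only: topology_inverse')
qed

lemma partition_on_class_decomp: "partition_on (topspace X) (class_decomp X F)"
  unfolding partition_on_def disjoint_def class_decomp_def elem_class_def by auto

lemma topspace_decomp_space:
  assumes "partition_on (topspace X) G"
  shows "topspace (decomp_space X G) = G"
proof -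
  have "disjoint G" "\<Union>G = topspace X"
    using assms unfolding partition_on_def by auto
  then have "openin (decomp_space X G) G" by (simp add: openin_decomp_space)
  then show ?thesis
    using openin_decomp_space[OF \<open>disjoint G\<close>, of X "topspace (decomp_space X G)"]
      openin_subset[of "decomp_space X G" G] by blast
qed

lemma quotient_map_class_space:
  "quotient_map X (class_space X F) (elem_class X F)"
proof -
  have p: "partition_on (topspace X) (class_decomp X F)" by (rule partition_on_class_decomp)
  then have dis: "disjoint (class_decomp X F)" unfolding partition_on_def by blast
  have top: "topspace (class_space X F) = class_decomp X F"
    using p by (simp add: class_space_def topspace_decomp_space)
  have pre: "{x \<in> topspace X. elem_class X F x \<in> W} = \<Union>W" if "W \<subseteq> class_decomp X F" for W
  proof (intro equalityI subsetI)
    fix x assume "x \<in> {x \<in> topspace X. elem_class X F x \<in> W}"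
    moreover from this have "x \<in> elem_class X F x" by (simp add: elem_class_def)
    ultimately show "x \<in> \<Union>W" by blast
  next
    fix x assume "x \<in> \<Union>W"
    then obtain L where L: "L \<in> W" "x \<in> L" by blast
    then obtain z where "L = elem_class X F z" using \<open>W \<subseteq> _\<close> unfolding class_decomp_def by blast
    then have "x \<in> topspace X" "elem_class X F x = L" using L by (auto simp: elem_class_def)
    then show "x \<in> {x \<in> topspace X. elem_class X F x \<in> W}" using L by blast
  qed
  show ?thesis
    unfolding quotient_map_def top
  proof (intro conjI allI impI)
    show "elem_class X F ` topspace X = class_decomp X F" by (simp add: class_decomp_def)
    show "openin X {x \<in> topspace X. elem_class X F x \<in> W} = openin (class_space X F) W"
      if "W \<subseteq> class_decomp X F" for W
      unfolding pre[OF that] class_space_def openin_decomp_space[OF dis] using that by simp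
  qed
qed

end

theory Submission
  imports Defs
begin

text \<open>Equicontinuity says that an element passing close to \<open>x\<close> stays uniformly close to the whole
  element of \<open>x\<close>. Applied to an element that accumulates at \<open>y\<close>, this makes element closures either
  equal or disjoint, so element classes are element closures. Applied to varying elements, it makes
  \<open>R\<close> closed. It also makes the projection onto the class space open, and an open quotient by a
  closed relation is Hausdorff. When element closures are compact, an open neighbourhood of one of
  them contains a uniform neighbourhood, hence all nearby element closures; so
  \<open>{z. cl (F z) \<subseteq> U}\<close> is open for every open \<open>U\<close>, which gives the remaining assertions.\<close>

section \<open>Hausdorff distance and elements of a partition\<close>

lemma hausdorff_dist_lessD:
  assumes "hausdorff_dist m A B < ereal e" "a \<in> A"
  shows "\<exists>b\<in>B. mdist m a b < e"
proof -
  obtain r where r: "A \<subseteq> U_nbhd m r B" "r < e"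
    using assms(1) unfolding hausdorff_dist_def Inf_less_iff by auto
  then obtain b where "b \<in> B" "mdist m a b < r"
    using assms(2) unfolding U_nbhd_def by blast
  then show ?thesis using r(2) by force
qed

lemma elem_of_mem:
  assumes "partition_on S F" "x \<in> S"
  shows "elem_of F x \<in> F" "x \<in> elem_of F x"
proof -
  obtain L where "L \<in> F" "x \<in> L" using assms unfolding partition_on_def by blast
  then show "elem_of F x \<in> F" "x \<in> elem_of F x"
    using elem_of_eqI[OF assms(1)] by auto
qed

lemma elem_of_subset:
  assumes "partition_on S F" "x \<in> S"
  shows "elem_of F x \<subseteq> S"
  using elem_of_mem(1)[OF assms] assms(1) unfolding partition_on_def by blast

lemma elem_of_cong:
  assumes "partition_on S F" "x \<in> S" "y \<in> elem_of F x"
  shows "elem_of F y = elem_of F x"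
  using elem_of_eqI[OF assms(1) elem_of_mem(1)[OF assms(1,2)] assms(3)] .

lemma invariantI:
  assumes "partition_on S F" "A \<subseteq> S" "\<And>x. x \<in> A \<Longrightarrow> elem_of F x \<subseteq> A"
  shows "invariant F A"
  unfolding invariant_def
proof (intro exI conjI)
  show "elem_of F ` A \<subseteq> F" using elem_of_mem(1)[OF assms(1)] assms(2) by blast
  show "A = \<Union>(elem_of F ` A)" using elem_of_mem(2)[OF assms(1)] assms(2,3) by blast
qed

section \<open>Element closures for a fixed metric witnessing equicontinuity\<close>

locale equicontinuous_decomposition =
  fixes m :: "'a metric" and F :: "'a set set"
  assumes partition: "partition_on (mspace m) F"
    and equicontinuous: "weakly_equicontinuous_metric m F"
begin

sublocale Metric_space "mspace m" "mdist m"
  by simp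

abbreviation "X \<equiv> mtopology_of m"
abbreviation "cl \<equiv> elem_closure X F"

lemma X_eq: "X = mtopology"
  by (simp add: mtopology_of_def)

lemma openin_iff_mball:
  "openin X U \<longleftrightarrow> U \<subseteq> mspace m \<and> (\<forall>x. x \<in> U \<longrightarrow> (\<exists>r>0. mball x r \<subseteq> U))"
  by (simp add: X_eq openin_mtopology)

lemma openin_X_mball: "openin X (mball x r)"
  by (simp add: X_eq)

lemma cl_iff:
  assumes "x \<in> mspace m"
  shows "y \<in> cl x \<longleftrightarrow> y \<in> mspace m \<and> (\<forall>e>0. \<exists>z\<in>elem_of F x. mdist m y z < e)"
  using elem_of_subset[OF partition assms]
  by (fastforce simp: elem_closure_def X_eq metric_closure_of)

lemma cl_subset: "cl x \<subseteq> mspace m"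
  using closure_of_subset_topspace[of X "elem_of F x"] by (simp add: elem_closure_def)

lemma elem_of_subset_cl: "x \<in> mspace m \<Longrightarrow> elem_of F x \<subseteq> cl x"
  unfolding elem_closure_def
  by (rule closure_of_subset) (simp add: elem_of_subset[OF partition])

lemma mem_cl: "x \<in> mspace m \<Longrightarrow> x \<in> cl x"
  using elem_of_subset_cl elem_of_mem(2)[OF partition] by blast

text \<open>The form in which equicontinuity is used throughout: \<open>a\<close> may lie in the
  closure, while \<open>b\<close> lies in the element itself, so that membership in
  \<open>cl y\<close> can be tested by \<open>cl_iff\<close>. Half of \<open>e\<close> pays for
  approximating \<open>a\<close> by a point of the element of \<open>x\<close>, the other half for
  the Hausdorff distance between the two elements.\<close>

lemma equicontinuous_cl:
  assumes "e > 0"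
  obtains d where "d > 0" "\<And>x y a. \<lbrakk>x \<in> mspace m; y \<in> mspace m; mdist m x y < d; a \<in> cl x\<rbrakk>
    \<Longrightarrow> \<exists>b\<in>elem_of F y. mdist m a b < e"
proof -
  obtain d where d: "d > 0" "\<And>x y. \<lbrakk>x \<in> mspace m; y \<in> mspace m; mdist m x y < d\<rbrakk>
      \<Longrightarrow> hausdorff_dist m (elem_of F x) (elem_of F y) < ereal (e/2)"
    using equicontinuous assms unfolding weakly_equicontinuous_metric_def by (meson half_gt_zero)
  show ?thesis
  proof (rule that[OF d(1)])
    fix x y a
    assume xy: "x \<in> mspace m" "y \<in> mspace m" "mdist m x y < d" and a: "a \<in> cl x"
    obtain a' where a': "a' \<in> elem_of F x" "mdist m a a' < e/2"
      using a cl_iff[OF xy(1)] assms by (meson half_gt_zero)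
    obtain b where b: "b \<in> elem_of F y" "mdist m a' b < e/2"
      using hausdorff_dist_lessD[OF d(2)[OF xy] a'(1)] by blast
    have "mdist m a b \<le> mdist m a a' + mdist m a' b"
      using a a' b cl_subset elem_of_subset[OF partition xy(1)] elem_of_subset[OF partition xy(2)]
      by (intro triangle) auto
    then show "\<exists>b\<in>elem_of F y. mdist m a b < e" using a' b by force
  qed
qed

text \<open>Equicontinuity carries \<open>y'\<close> from the closure at \<open>x'\<close> to a
  point of the element of \<open>x\<close>, and \<open>y'\<close> is already close to
  \<open>y\<close>. This is the closedness of R in metric terms; the prolongation, R-closedness and
  the separation of classes all reduce to it.\<close>

lemma cl_limit:
  assumes "x \<in> mspace m" "y \<in> mspace m"
    and near: "\<And>e. e > 0 \<Longrightarrow>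
      \<exists>x'\<in>mspace m. \<exists>y'\<in>cl x'. mdist m x x' < e \<and> mdist m y y' < e"
  shows "y \<in> cl x"
  unfolding cl_iff[OF assms(1)]
proof (intro conjI allI impI)
  fix e :: real assume "e > 0"
  then have "e/2 > 0" by simp
  from equicontinuous_cl[OF this] obtain d where d: "d > 0"
    "\<And>x y a. \<lbrakk>x \<in> mspace m; y \<in> mspace m; mdist m x y < d; a \<in> cl x\<rbrakk>
      \<Longrightarrow> \<exists>b\<in>elem_of F y. mdist m a b < e/2" by blast
  \<comment> \<open>One radius has to serve both purposes: \<open>d\<close> for applying
    equicontinuity to \<open>x'\<close>, and \<open>e/2\<close> for the distance from
    \<open>y\<close> to \<open>y'\<close>.\<close>
  obtain x' y' where x': "x' \<in> mspace m" "y' \<in> cl x'" "mdist m x x' < d" "mdist m y y' < e/2"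
    using near[of "min d (e/2)"] d(1) \<open>e > 0\<close> by auto
  obtain b where b: "b \<in> elem_of F x" "mdist m y' b < e/2"
    using d(2)[OF x'(1) assms(1) _ x'(2)] x'(3) by (auto simp: commute)
  have "mdist m y b \<le> mdist m y y' + mdist m y' b"
    using assms x' b cl_subset elem_of_subset[OF partition assms(1)] by (intro triangle) auto
  then show "\<exists>z\<in>elem_of F x. mdist m y z < e" using b x' by force
qed (fact assms(2))

text \<open>The element of \<open>x\<close> has points \<open>z\<close> arbitrarily close to
  \<open>y\<close>, and all of them satisfy \<open>cl z = cl x\<close>. For \<open>cl x\<close>
  inside \<open>cl y\<close>, these \<open>z\<close> together with the unmoved point
  \<open>a\<close> feed \<open>cl_limit\<close>. For the converse, equicontinuity between
  \<open>y\<close> and \<open>z\<close> moves \<open>a\<close> to a nearby point of the element of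
  \<open>z\<close>, which is the element of \<open>x\<close>. The converse is not a mere property of
  closures, since the closure of an element of a general decomposition need not be
  invariant.\<close>

lemma cl_eq:
  assumes x: "x \<in> mspace m" and y: "y \<in> cl x"
  shows "cl y = cl x"
proof -
  have y': "y \<in> mspace m" using y cl_subset by blast
  have near: "\<exists>z\<in>mspace m. mdist m y z < e \<and> cl z = cl x" if e: "e > 0" for e
  proof -
    obtain z where "z \<in> elem_of F x" "mdist m y z < e"
      using y e unfolding cl_iff[OF x] by blast
    then show ?thesis
      using elem_of_cong[OF partition x] elem_of_subset[OF partition x]
      by (force simp: elem_closure_def)
  qed
  show ?thesis
  proof
    show "cl x \<subseteq> cl y"
    proof
      fix a assume a: "a \<in> cl x"
      then have a': "a \<in> mspace m" using cl_subset by blast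
      show "a \<in> cl y"
      proof (rule cl_limit[OF y' a'])
        fix e :: real assume "e > 0"
        then obtain z where "z \<in> mspace m" "mdist m y z < e" "cl z = cl x" using near by blast
        then show "\<exists>z\<in>mspace m. \<exists>b\<in>cl z. mdist m y z < e \<and> mdist m a b < e"
          using a a' \<open>e > 0\<close> by force
      qed
    qed
    show "cl y \<subseteq> cl x"
    proof
      fix a assume a: "a \<in> cl y"
      then have a': "a \<in> mspace m" using cl_subset by blast
      show "a \<in> cl x"
        unfolding cl_iff[OF x]
      proof (intro conjI allI impI)
        fix e :: real assume "e > 0"
        from equicontinuous_cl[OF this] obtain d where d: "d > 0"
          "\<And>x y a. \<lbrakk>x \<in> mspace m; y \<in> mspace m; mdist m x y < d; a \<in> cl x\<rbrakk>
            \<Longrightarrow> \<exists>b\<in>elem_of F y. mdist m a b < e" by blast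
        obtain z where z: "z \<in> elem_of F x" "mdist m y z < d"
          using y d(1) unfolding cl_iff[OF x] by blast
        then show "\<exists>b\<in>elem_of F x. mdist m a b < e"
          using d(2)[OF y' _ z(2) a] elem_of_subset[OF partition x] elem_of_cong[OF partition x z(1)]
          by auto
      qed (fact a')
    qed
  qed
qed

lemma elem_class_eq_cl: "x \<in> mspace m \<Longrightarrow> elem_class X F x = cl x"
  unfolding elem_class_def
proof (intro equalityI subsetI)
  assume x: "x \<in> mspace m"
  show "y \<in> cl x" if "y \<in> {y \<in> topspace X. cl x = cl y}" for y
    using that mem_cl[of y] by simp
  show "y \<in> {y \<in> topspace X. cl x = cl y}" if "y \<in> cl x" for y
    using that cl_eq[OF x that] cl_subset by force
qed

lemma class_decomp_eq: "class_decomp X F = cl ` mspace m"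
  unfolding class_decomp_def by (simp add: elem_class_eq_cl)

section \<open>Prolongations and R-closedness\<close>

lemma characteristic_0: "characteristic_0 X F"
  unfolding characteristic_0_def
proof (intro ballI equalityI subsetI)
  fix x y assume "x \<in> topspace X" and y: "y \<in> cl x"
  then have x: "x \<in> mspace m" by simp
  \<comment> \<open>The nets witnessing the prolongation are the constant net at \<open>x\<close>
    and a sequence in its element that tends to \<open>y\<close>.\<close>
  have "\<forall>n. \<exists>z\<in>elem_of F x. mdist m y z < inverse (real (Suc n))"
    using y unfolding cl_iff[OF x] by simp
  then obtain s where s: "\<And>n. s n \<in> elem_of F x" "\<And>n. mdist m y (s n) < inverse (real (Suc n))"
    by metis
  have "prolongation_nets X F x y UNIV {(i, j :: nat). i \<le> j} (\<lambda>_. x) s"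
    unfolding prolongation_nets_def
  proof (intro conjI ballI)
    show "directed_set UNIV {(i, j :: nat). i \<le> j}"
      unfolding directed_set_def by (auto intro: max.cobounded1 max.cobounded2)
    show "net_converges X UNIV {(i, j :: nat). i \<le> j} (\<lambda>_. x) x"
      using x by (auto simp: net_converges_def)
    show "net_converges X UNIV {(i, j). i \<le> j} s y"
      unfolding net_converges_def
    proof (intro conjI allI impI)
      show "y \<in> topspace X" using y cl_subset by auto
      fix U assume "openin X U \<and> y \<in> U"
      then obtain r where r: "r > 0" "mball y r \<subseteq> U" unfolding openin_iff_mball by blast
      obtain N where N: "inverse (real (Suc N)) < r" using reals_Archimedean[OF r(1)] by auto
      have "s n \<in> U" if "N \<le> n" for n
      proof -
        have "inverse (real (Suc n)) \<le> inverse (real (Suc N))"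
          using that by (intro le_imp_inverse_le) auto
        then have "mdist m y (s n) < r" using s(2)[of n] N by linarith
        moreover have "s n \<in> mspace m" "y \<in> mspace m"
          using s(1) y cl_subset elem_of_subset[OF partition x] by blast+
        ultimately show ?thesis using r(2) by auto
      qed
      then show "\<exists>a\<in>UNIV. \<forall>b\<in>UNIV. (a, b) \<in> {(i, j). i \<le> j} \<longrightarrow> s b \<in> U" by auto
    qed
  qed (use x s elem_of_subset[OF partition x] in auto)
  \<comment> \<open>These nets are indexed by the natural numbers and not by pairs of sets, hence
    the change of index type.\<close>
  then show "y \<in> prolongation X F x" by (rule prolongation_any_index)
next
  fix x y assume "x \<in> topspace X" and "y \<in> prolongation X F x"
  then obtain I :: "('a set \<times> 'a set) set" and r xs ys
    where nets: "prolongation_nets X F x y I r xs ys" unfolding prolongation_def by blast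
  have x: "x \<in> mspace m" and y: "y \<in> mspace m"
    using nets by (auto simp: prolongation_nets_def net_converges_def)
  show "y \<in> cl x"
  \<comment> \<open>An index \<open>c\<close> beyond both \<open>a\<close> and \<open>b\<close>
    supplies the nearby pair \<open>xs c\<close>, \<open>ys c\<close> that \<open>cl_limit\<close>
    asks for.\<close>
  proof (rule cl_limit[OF x y])
    fix e :: real assume "e > 0"
    have ball: "\<exists>a\<in>I. \<forall>b\<in>I. (a, b) \<in> r \<longrightarrow> s b \<in> mball z e"
      if "net_converges X I r s z" "z \<in> mspace m" for s z
    proof -
      have "z \<in> mball z e" using that(2) \<open>e > 0\<close> by simp
      then show ?thesis using that(1) openin_X_mball unfolding net_converges_def by blast
    qed
    obtain a where a: "a \<in> I" "\<forall>c\<in>I. (a, c) \<in> r \<longrightarrow> xs c \<in> mball x e"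
      using ball[OF _ x] nets unfolding prolongation_nets_def by blast
    obtain b where b: "b \<in> I" "\<forall>c\<in>I. (b, c) \<in> r \<longrightarrow> ys c \<in> mball y e"
      using ball[OF _ y] nets unfolding prolongation_nets_def by blast
    obtain c where c: "c \<in> I" "(a, c) \<in> r" "(b, c) \<in> r"
      using nets a(1) b(1) unfolding prolongation_nets_def directed_set_def by blast
    have "xs c \<in> mspace m" "ys c \<in> elem_of F (xs c)"
      using nets c(1) by (auto simp: prolongation_nets_def)
    then show "\<exists>x'\<in>mspace m. \<exists>y'\<in>cl x'. mdist m x x' < e \<and> mdist m y y' < e"
      using a(2) b(2) c elem_of_subset_cl by fastforce
  qed
qed

text \<open>The contrapositive of \<open>cl_limit\<close>, stated with balls: a product
  neighbourhood of the pair that misses R. It gives R-closedness at once and later separates points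
  of the class space.\<close>

lemma separate_cl:
  assumes "x \<in> mspace m" "y \<in> mspace m" "y \<notin> cl x"
  obtains e where "e > 0" "\<And>u v. u \<in> mball x e \<Longrightarrow> v \<in> mball y e \<Longrightarrow> v \<notin> cl u"
proof -
  have "\<exists>e>0. \<forall>x'\<in>mspace m. \<forall>y'\<in>cl x'. \<not> (mdist m x x' < e \<and> mdist m y y' < e)"
    using cl_limit[OF assms(1,2)] assms(3) by blast
  then show ?thesis using that by (metis in_mball)
qed

lemma R_closed: "R_closed X F"
proof -
  let ?R = "{(x, y). x \<in> topspace X \<and> y \<in> topspace X \<and> y \<in> cl x}"
  have "openin (prod_topology X X) (topspace (prod_topology X X) - ?R)"
    unfolding openin_prod_topology_alt
  proof (intro allI impI)
    fix x y assume "(x, y) \<in> topspace (prod_topology X X) - ?R"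
    then have xy: "x \<in> mspace m" "y \<in> mspace m" "y \<notin> cl x" by auto
    from separate_cl[OF this] obtain e where e: "e > 0"
      "\<And>u v. u \<in> mball x e \<Longrightarrow> v \<in> mball y e \<Longrightarrow> v \<notin> cl u" by blast
    show "\<exists>U V. openin X U \<and> openin X V \<and> x \<in> U \<and> y \<in> V \<and>
        U \<times> V \<subseteq> topspace (prod_topology X X) - ?R"
    proof (intro exI conjI)
      show "openin X (mball x e)" "openin X (mball y e)" by (simp_all add: openin_X_mball)
      show "x \<in> mball x e" "y \<in> mball y e" using xy e(1) by auto
      show "mball x e \<times> mball y e \<subseteq> topspace (prod_topology X X) - ?R"
        using e(2) mball_subset_mspace by auto
    qed
  qed
  then show ?thesis unfolding R_closed_def closedin_def by auto
qed

section \<open>The class space and minimality of element closures\<close>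

lemma openin_class_space:
  "openin (class_space X F) W \<longleftrightarrow> W \<subseteq> cl ` mspace m \<and> openin X (\<Union>W)"
  using partition_on_class_decomp[of X F]
  by (simp add: class_space_def openin_decomp_space partition_on_def class_decomp_eq)

lemma topspace_class_space: "topspace (class_space X F) = cl ` mspace m"
  using topspace_decomp_space[OF partition_on_class_decomp, of X F]
  by (simp add: class_space_def class_decomp_eq)

text \<open>This is openness of the projection onto the class space. If \<open>z\<close> lies in
  \<open>cl u\<close> with \<open>u\<close> in \<open>U\<close>, then elements of points near
  \<open>z\<close> pass close to \<open>u\<close>, hence meet \<open>U\<close>.\<close>

lemma openin_saturation:
  assumes "openin X U"
  shows "openin X (\<Union>(cl ` U))"
  unfolding openin_iff_mball
proof (intro conjI allI impI)
  have U: "U \<subseteq> mspace m" using openin_subset[OF assms] by simp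
  show "\<Union>(cl ` U) \<subseteq> mspace m" using cl_subset by blast
  fix z assume "z \<in> \<Union>(cl ` U)"
  then obtain u where u: "u \<in> U" "z \<in> cl u" by blast
  have z: "z \<in> mspace m" using u(2) cl_subset by blast
  \<comment> \<open>The roles of \<open>u\<close> and \<open>z\<close> are exchanged because
    equicontinuity is applied at \<open>z\<close>, with \<open>u\<close> as the point of the closure
    to be moved.\<close>
  have uz: "u \<in> cl z" using cl_eq[OF _ u(2)] U u(1) mem_cl by blast
  obtain e where e: "e > 0" "mball u e \<subseteq> U"
    using assms u(1) unfolding openin_iff_mball by blast
  from equicontinuous_cl[OF e(1)] obtain d where d: "d > 0"
    "\<And>x y a. \<lbrakk>x \<in> mspace m; y \<in> mspace m; mdist m x y < d; a \<in> cl x\<rbrakk>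
      \<Longrightarrow> \<exists>b\<in>elem_of F y. mdist m a b < e" by blast
  have "w \<in> \<Union>(cl ` U)" if "w \<in> mball z d" for w
  proof -
    have w: "w \<in> mspace m" "mdist m z w < d" using that by auto
    obtain b where b: "b \<in> elem_of F w" "mdist m u b < e" using d(2)[OF z w uz] by blast
    then have "b \<in> cl w" using elem_of_subset_cl[OF w(1)] by blast
    moreover have "b \<in> mball u e"
      using b(2) U u(1) calculation cl_subset[of w] by (simp add: subsetD)
    then have "b \<in> U" using e(2) by blast
    ultimately show ?thesis using cl_eq[OF w(1)] mem_cl[OF w(1)] by blast
  qed
  then show "\<exists>r>0. mball z r \<subseteq> \<Union>(cl ` U)" using d(1) by blast
qed

text \<open>The separating sets are the images of the two balls from \<open>separate_cl\<close>,
  open because the projection is open. A common class \<open>cl u = cl v\<close> would put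
  \<open>v\<close> into \<open>cl u\<close>.\<close>

lemma Hausdorff_class_space: "Hausdorff_space (class_space X F)"
  unfolding Hausdorff_space_def topspace_class_space
proof (intro allI impI)
  fix K L assume KL: "K \<in> cl ` mspace m \<and> L \<in> cl ` mspace m \<and> K \<noteq> L"
  then obtain x y where xy: "x \<in> mspace m" "y \<in> mspace m" "K = cl x" "L = cl y" by blast
  have "y \<notin> cl x" using cl_eq xy KL by blast
  from separate_cl[OF xy(1,2) this] obtain e where e: "e > 0"
    "\<And>u v. u \<in> mball x e \<Longrightarrow> v \<in> mball y e \<Longrightarrow> v \<notin> cl u" by blast
  show "\<exists>U V. openin (class_space X F) U \<and> openin (class_space X F) V \<and> K \<in> U \<and> L \<in> V \<and> disjnt U V"
  proof (intro exI conjI)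
    show "openin (class_space X F) (cl ` mball x e)" "openin (class_space X F) (cl ` mball y e)"
      unfolding openin_class_space
      using openin_saturation[OF openin_X_mball] mball_subset_mspace by blast+
    show "K \<in> cl ` mball x e" "L \<in> cl ` mball y e" using xy e(1) by auto
    show "disjnt (cl ` mball x e) (cl ` mball y e)"
      unfolding disjnt_iff using e(2) mem_cl mball_subset_mspace by blast
  qed
qed

lemma invariant_cl:
  assumes "x \<in> mspace m"
  shows "invariant F (cl x)"
  using cl_subset elem_of_subset_cl cl_eq[OF assms] by (intro invariantI[OF partition]) blast+

lemma pointwise_almost_periodic: "pointwise_almost_periodic X F"
  using invariant_cl cl_eq by (simp add: pointwise_almost_periodic_def minimal_set_def)

end

section \<open>Compact element closures\<close>

locale compact_equicontinuous_decomposition = equicontinuous_decomposition +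
  assumes compact_cl: "x \<in> mspace m \<Longrightarrow> compactin X (cl x)"
begin

text \<open>Compactness of \<open>cl z\<close> yields a uniform radius \<open>e\<close> whose balls
  around points of \<open>cl z\<close> stay in \<open>U\<close>. Equicontinuity then keeps
  \<open>cl w\<close> within \<open>e\<close> of the element of \<open>z\<close> for all
  \<open>w\<close> near \<open>z\<close>.\<close>

lemma openin_cl_subset:
  assumes "openin X U"
  shows "openin X {z \<in> mspace m. cl z \<subseteq> U}"
  unfolding openin_iff_mball
proof (intro conjI allI impI)
  fix z assume "z \<in> {z \<in> mspace m. cl z \<subseteq> U}"
  then have z: "z \<in> mspace m" "cl z \<subseteq> U" by auto
  \<comment> \<open>A Lebesgue number of the cover consisting of \<open>U\<close> alone.\<close>
  obtain e where e: "e > 0" "\<forall>a\<in>cl z. mball a e \<subseteq> U"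
    using lebesgue_number[of "cl z" "{U}"] compact_cl[OF z(1)] z(2) assms unfolding X_eq by auto
  from equicontinuous_cl[OF e(1)] obtain d where d: "d > 0"
    "\<And>x y a. \<lbrakk>x \<in> mspace m; y \<in> mspace m; mdist m x y < d; a \<in> cl x\<rbrakk>
      \<Longrightarrow> \<exists>b\<in>elem_of F y. mdist m a b < e" by blast
  have "cl w \<subseteq> U" if "w \<in> mball z d" for w
  proof
    have w: "w \<in> mspace m" "mdist m z w < d" using that by auto
    fix a assume a: "a \<in> cl w"
    obtain b where b: "b \<in> elem_of F z" "mdist m a b < e"
      using d(2)[OF w(1) z(1) _ a] w(2) by (auto simp: commute)
    have "b \<in> cl z" using b(1) elem_of_subset_cl[OF z(1)] by blast
    moreover have "a \<in> mball b e" using b(2) a \<open>b \<in> cl z\<close> cl_subset by (auto simp: commute)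
    ultimately show "a \<in> U" using e(2) by blast
  qed
  then have "mball z d \<subseteq> {z \<in> mspace m. cl z \<subseteq> U}" using mball_subset_mspace by blast
  then show "\<exists>r>0. mball z r \<subseteq> {z \<in> mspace m. cl z \<subseteq> U}" using d(1) by blast
qed auto

lemma cl_subset_saturated:
  assumes "z \<in> {z \<in> mspace m. cl z \<subseteq> U}"
  shows "cl z \<subseteq> {z \<in> mspace m. cl z \<subseteq> U}"
  using assms cl_eq[of z] cl_subset[of z] by auto

text \<open>Element closures are equal or disjoint, so a point \<open>z\<close> lies outside the
  saturation of \<open>A\<close> exactly when \<open>cl z\<close> misses \<open>A\<close>. The
  complement of the saturation is therefore of the form treated in
  \<open>openin_cl_subset\<close>.\<close>

lemma weakly_almost_periodic: "weakly_almost_periodic X F"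
  unfolding weakly_almost_periodic_def
proof (intro conjI allI impI)
  fix A assume A: "closedin X A"
  then have sub: "A \<subseteq> mspace m" using closedin_subset by fastforce
  have "z \<notin> (\<Union>x\<in>A. cl x) \<longleftrightarrow> cl z \<subseteq> mspace m - A" if z: "z \<in> mspace m" for z
  proof
    show "z \<notin> (\<Union>x\<in>A. cl x)" if "cl z \<subseteq> mspace m - A"
      using that cl_eq mem_cl sub by blast
    show "cl z \<subseteq> mspace m - A" if "z \<notin> (\<Union>x\<in>A. cl x)"
      using that cl_eq[OF z] mem_cl[OF z] cl_subset by blast
  qed
  then have "mspace m - (\<Union>x\<in>A. cl x) = {z \<in> mspace m. cl z \<subseteq> mspace m - A}" by blast
  moreover have "openin X (mspace m - A)" using A by (simp add: closedin_def)
  ultimately show "closedin X (\<Union>x\<in>A. cl x)"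
    using openin_cl_subset cl_subset by (auto simp: closedin_def)
qed (fact pointwise_almost_periodic)

lemma upper_semicontinuous: "upper_semicontinuous X (class_decomp X F)"
  unfolding upper_semicontinuous_def weakly_upper_semicontinuous_def
proof (intro conjI ballI allI impI partition_on_class_decomp)
  fix L assume "L \<in> class_decomp X F"
  then obtain x where x: "x \<in> mspace m" "L = cl x" unfolding class_decomp_eq by blast
  show "closedin X L" unfolding x(2) elem_closure_def by simp
  show "compactin X L" using compact_cl x by blast
  fix U assume U: "openin X U \<and> L \<subseteq> U"
  \<comment> \<open>The largest union of element closures contained in \<open>U\<close>.\<close>
  let ?V = "{z \<in> mspace m. cl z \<subseteq> U}"
  show "\<exists>V. openin X V \<and> L \<subseteq> V \<and> V \<subseteq> U \<and> invariant (class_decomp X F) V"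
  proof (intro exI conjI)
    show "openin X ?V" using openin_cl_subset U by blast
    show "L \<subseteq> ?V" using cl_subset_saturated[of x U] x U by blast
    show "?V \<subseteq> U" using mem_cl by blast
    have "?V = \<Union>(cl ` ?V)" using cl_subset_saturated mem_cl by blast
    then show "invariant (class_decomp X F) ?V"
      unfolding invariant_def class_decomp_eq by (intro exI[of _ "cl ` ?V"]) blast
  qed
qed

text \<open>As \<open>U\<close> need not be open, the saturated set is formed inside an open
  \<open>W\<close> between \<open>cl x\<close> and \<open>U\<close>. A union of element closures
  contains the element of each of its points, which gives invariance under \<open>F\<close>.\<close>

lemma invariant_neighbourhood:
  assumes x: "x \<in> mspace m" and "nbhd_of_set X (cl x) U"
  shows "\<exists>V. openin X V \<and> invariant F V \<and> cl x \<subseteq> V \<and> V \<subseteq> U"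
proof -
  obtain W where W: "openin X W" "cl x \<subseteq> W" "W \<subseteq> U"
    using assms(2) unfolding nbhd_of_set_def by blast
  let ?V = "{z \<in> mspace m. cl z \<subseteq> W}"
  show ?thesis
  proof (intro exI conjI)
    show "openin X ?V" using openin_cl_subset W by blast
    show "cl x \<subseteq> ?V" using cl_subset_saturated[of x W] x W by blast
    show "?V \<subseteq> U" using mem_cl W by blast
    show "invariant F ?V"
    proof (rule invariantI[OF partition])
      show "elem_of F z \<subseteq> ?V" if "z \<in> ?V" for z
        using that cl_subset_saturated[OF that] elem_of_subset_cl[of z] by blast
    qed auto
  qed
qed

end

theorem theorem2:
  fixes X :: "'a topology" and F :: "'a set set"
  assumes "metrizable_space X"
    and "partition_on (topspace X) F"
    and "weakly_equicontinuous X F"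
  shows "characteristic_0 X F
    \<and> R_closed X F
    \<and> Hausdorff_space (class_space X F)
    \<and> ((\<forall>x \<in> topspace X. compactin X (elem_closure X F x)) \<longrightarrow>
         weakly_almost_periodic X F
         \<and> upper_semicontinuous X (class_decomp X F)
         \<and> (\<forall>x \<in> topspace X. \<forall>U. nbhd_of_set X (elem_closure X F x) U \<longrightarrow>
              (\<exists>V. openin X V \<and> invariant F V \<and> elem_closure X F x \<subseteq> V \<and> V \<subseteq> U)))"
proof -
  \<comment> \<open>The chosen metric is one for which equicontinuity holds; as it induces
    \<open>X\<close>, the results of the locales transfer by rewriting.\<close>
  obtain m where m: "mtopology_of m = X" "weakly_equicontinuous_metric m F"
    using assms(3) unfolding weakly_equicontinuous_def by blast
  then have top: "topspace X = mspace m" by auto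
  interpret equicontinuous_decomposition m F
    using assms(2) m top by unfold_locales auto
  show ?thesis
  proof (intro conjI impI)
    show "characteristic_0 X F" using characteristic_0 m(1) by simp
    show "R_closed X F" using R_closed m(1) by simp
    show "Hausdorff_space (class_space X F)" using Hausdorff_class_space m(1) by simp
  next
    assume "\<forall>x \<in> topspace X. compactin X (elem_closure X F x)"
    then interpret compact_equicontinuous_decomposition m F
      using m(1) top by unfold_locales auto
    show "weakly_almost_periodic X F" using weakly_almost_periodic m(1) by simp
    show "upper_semicontinuous X (class_decomp X F)" using upper_semicontinuous m(1) by simp
    show "\<forall>x \<in> topspace X. \<forall>U. nbhd_of_set X (elem_closure X F x) U \<longrightarrow>
        (\<exists>V. openin X V \<and> invariant F V \<and> elem_closure X F x \<subseteq> V \<and> V \<subseteq> U)"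
      using invariant_neighbourhood m(1) top by simp
  qed
qed

end
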